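(* Let $\mathfrak{g}$ be a $2n$-dimensional almost abelian real Lie algebra endowed with a complex structure $J$. Then there do not exist symplectic structures $\Omega$ on $\mathfrak{g}$ taming $J$, unless $(\mathfrak{g},J)$ admits Kähler metrics.
   Context: A solvable Lie algebra is almost abelian if its nilradical is abelian and has codimension one. No unimodularity is assumed. A complex structure on $\mathfrak{g}$ is $J\in\mathrm{End}(\mathfrak{g})$ with $J^2=-\mathrm{Id}$ and $[X,Y]-J[JX,Y]-J[X,JY]-[JX,JY]=0$ for all $X,Y$. A symplectic structure on $\mathfrak{g}$ is a non-degenerate 2-form $\Omega\in\Lambda^2\mathfrak{g}^*$ closed under the Chevalley–Eilenberg differential. $\Omega$ tames $J$ if the $(1,1)$-part of $\Omega$ is positive, i.e. $\Omega(X,JX)>0$ for all $X\neq0$. A Kähler metric on $(\mathfrak{g},J)$ is an inner product $g$ with $g(J\cdot,J\cdot)=g$ such that the fundamental form $\omega=g(J\cdot,\cdot)$ is closed.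
   Formalization: The integrability condition is taken as the standard vanishing Nijenhuis tensor, [X,Y]+J[JX,Y]+J[X,JY]-[JX,JY]=0; the printed minus signs on the mixed terms are a misprint (multiplication by i on a nonabelian complex Lie algebra would fail them). *)

theory Defs
  imports "HOL-Analysis.Analysis"
begin

definition lie_bracket :: "('a::real_vector \<Rightarrow> 'a \<Rightarrow> 'a) \<Rightarrow> bool" where
  "lie_bracket br \<longleftrightarrow> bilinear br \<and> (\<forall>x. br x x = 0) \<and>
     (\<forall>x y z. br x (br y z) + br y (br z x) + br z (br x y) = 0)"

definition bracket_span ::
  "('a::real_vector \<Rightarrow> 'a \<Rightarrow> 'a) \<Rightarrow> 'a set \<Rightarrow> 'a set \<Rightarrow> 'a set" where
  "bracket_span br S T = span {br x y |x y. x \<in> S \<and> y \<in> T}"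

primrec derived_series ::
  "('a::real_vector \<Rightarrow> 'a \<Rightarrow> 'a) \<Rightarrow> 'a set \<Rightarrow> nat \<Rightarrow> 'a set" where
  "derived_series br S 0 = S"
| "derived_series br S (Suc k) =
     bracket_span br (derived_series br S k) (derived_series br S k)"

primrec lower_central_series ::
  "('a::real_vector \<Rightarrow> 'a \<Rightarrow> 'a) \<Rightarrow> 'a set \<Rightarrow> nat \<Rightarrow> 'a set" where
  "lower_central_series br S 0 = S"
| "lower_central_series br S (Suc k) = bracket_span br S (lower_central_series br S k)"

definition solvable :: "('a::real_vector \<Rightarrow> 'a \<Rightarrow> 'a) \<Rightarrow> 'a set \<Rightarrow> bool" where
  "solvable br S \<longleftrightarrow> (\<exists>k. derived_series br S k = {0})"

definition nilpotent :: "('a::real_vector \<Rightarrow> 'a \<Rightarrow> 'a) \<Rightarrow> 'a set \<Rightarrow> bool" where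
  "nilpotent br S \<longleftrightarrow> (\<exists>k. lower_central_series br S k = {0})"

definition abelian :: "('a::real_vector \<Rightarrow> 'a \<Rightarrow> 'a) \<Rightarrow> 'a set \<Rightarrow> bool" where
  "abelian br S \<longleftrightarrow> (\<forall>x\<in>S. \<forall>y\<in>S. br x y = 0)"

definition lie_ideal :: "('a::real_vector \<Rightarrow> 'a \<Rightarrow> 'a) \<Rightarrow> 'a set \<Rightarrow> bool" where
  "lie_ideal br I \<longleftrightarrow> subspace I \<and> (\<forall>x. \<forall>y\<in>I. br x y \<in> I)"

text \<open>The nilradical is the sum of all nilpotent ideals, which in finite dimension is
  the largest nilpotent ideal.\<close>

definition nilradical :: "('a::real_vector \<Rightarrow> 'a \<Rightarrow> 'a) \<Rightarrow> 'a set" where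
  "nilradical br = span (\<Union>{I. lie_ideal br I \<and> nilpotent br I})"

text \<open>The codimension condition is meaningful for finite-dimensional algebras only,
  since \<^const>\<open>dim\<close> is 0 for infinite-dimensional spaces.\<close>

definition almost_abelian :: "('a::real_vector \<Rightarrow> 'a \<Rightarrow> 'a) \<Rightarrow> bool" where
  "almost_abelian br \<longleftrightarrow> solvable br UNIV \<and> abelian br (nilradical br) \<and>
     dim (nilradical br) + 1 = dim (UNIV :: 'a set)"

text \<open>Integrability is the vanishing of the Nijenhuis tensor,
  \<open>[X,Y] + J[JX,Y] + J[X,JY] - [JX,JY] = 0\<close>. The mixed terms must have the sign \<open>+\<close> here:
  the formula is quadratic in \<open>J\<close>, so replacing \<open>J\<close> by \<open>-J\<close> does not change it, and with the
  sign \<open>-\<close> the multiplication by \<open>i\<close> on a non-abelian complex Lie algebra would not be a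
  complex structure.\<close>

definition complex_structure ::
  "('a::real_vector \<Rightarrow> 'a \<Rightarrow> 'a) \<Rightarrow> ('a \<Rightarrow> 'a) \<Rightarrow> bool" where
  "complex_structure br J \<longleftrightarrow> linear J \<and> (\<forall>x. J (J x) = - x) \<and>
     (\<forall>x y. br x y + J (br (J x) y) + J (br x (J y)) - br (J x) (J y) = 0)"

definition two_form :: "('a::real_vector \<Rightarrow> 'a \<Rightarrow> real) \<Rightarrow> bool" where
  "two_form \<omega> \<longleftrightarrow> bilinear \<omega> \<and> (\<forall>x. \<omega> x x = 0)"

definition ce_differential ::
  "('a::real_vector \<Rightarrow> 'a \<Rightarrow> 'a) \<Rightarrow> ('a \<Rightarrow> 'a \<Rightarrow> real) \<Rightarrow> 'a \<Rightarrow> 'a \<Rightarrow> 'a \<Rightarrow> real" where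
  "ce_differential br \<omega> x y z = - \<omega> (br x y) z + \<omega> (br x z) y - \<omega> (br y z) x"

definition closed_two_form ::
  "('a::real_vector \<Rightarrow> 'a \<Rightarrow> 'a) \<Rightarrow> ('a \<Rightarrow> 'a \<Rightarrow> real) \<Rightarrow> bool" where
  "closed_two_form br \<omega> \<longleftrightarrow> two_form \<omega> \<and> (\<forall>x y z. ce_differential br \<omega> x y z = 0)"

definition symplectic_structure ::
  "('a::real_vector \<Rightarrow> 'a \<Rightarrow> 'a) \<Rightarrow> ('a \<Rightarrow> 'a \<Rightarrow> real) \<Rightarrow> bool" where
  "symplectic_structure br \<Omega> \<longleftrightarrow> closed_two_form br \<Omega> \<and>
     (\<forall>x. (\<forall>y. \<Omega> x y = 0) \<longrightarrow> x = 0)"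

definition tames :: "('a::real_vector \<Rightarrow> 'a \<Rightarrow> real) \<Rightarrow> ('a \<Rightarrow> 'a) \<Rightarrow> bool" where
  "tames \<Omega> J \<longleftrightarrow> (\<forall>x. x \<noteq> 0 \<longrightarrow> \<Omega> x (J x) > 0)"

definition inner_product_form :: "('a::real_vector \<Rightarrow> 'a \<Rightarrow> real) \<Rightarrow> bool" where
  "inner_product_form g \<longleftrightarrow> bilinear g \<and> (\<forall>x y. g x y = g y x) \<and>
     (\<forall>x. x \<noteq> 0 \<longrightarrow> g x x > 0)"

definition kaehler_metric ::
  "('a::real_vector \<Rightarrow> 'a \<Rightarrow> 'a) \<Rightarrow> ('a \<Rightarrow> 'a) \<Rightarrow> ('a \<Rightarrow> 'a \<Rightarrow> real) \<Rightarrow> bool" where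
  "kaehler_metric br J g \<longleftrightarrow> inner_product_form g \<and> (\<forall>x y. g (J x) (J y) = g x y) \<and>
     closed_two_form br (\<lambda>x y. g (J x) y)"

end

theory Submission
  imports Defs
begin

text \<open>Let \<open>N\<close> be the nilradical and \<open>\<Omega>\<close> a symplectic form taming \<open>J\<close>. Since \<open>N\<close> is a
  hyperplane, some \<open>k \<noteq> 0\<close> is \<open>\<Omega>\<close>-orthogonal to \<open>N\<close>; then \<open>k \<in> N\<close>, while
  \<open>\<Omega>(k, Jk) > 0\<close> gives \<open>Jk \<notin> N\<close>. Put \<open>B = ad (Jk)\<close>. Closedness makes \<open>B\<close> skew for \<open>\<Omega>\<close>
  on \<open>N\<close>, so \<open>B\<close> preserves the line of \<open>k\<close>, and integrability makes \<open>B\<close> preserve the maximal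
  \<open>J\<close>-invariant subspace \<open>N \<inter> JN\<close> and commute with \<open>J\<close> there. Hence \<open>B\<close> is also skew for the
  \<open>(1,1)\<close>-part of \<open>\<Omega>\<close> on \<open>N \<inter> JN\<close>. The orthogonal sum of the corresponding metric with the
  metric on the plane of \<open>k, Jk\<close> making these two vectors orthonormal is Kaehler.\<close>

section \<open>Linear algebra of ideals, hyperplanes and orthogonal vectors\<close>

lemma lie_ideal_nilradical:
  fixes br :: "'a::real_vector \<Rightarrow> 'a \<Rightarrow> 'a"
  assumes "lie_bracket br"
  shows "lie_ideal br (nilradical br)"
proof -
  let ?U = "\<Union>{I. lie_ideal br I \<and> nilpotent br I}"
  have "br x y \<in> span ?U" if "y \<in> span ?U" for x y
  proof -
    have lin: "linear (br x)"
      using assms by (simp add: lie_bracket_def bilinear_def)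
    have "br x ` ?U \<subseteq> ?U"
      by (auto simp: lie_ideal_def)
    then have "span (br x ` ?U) \<subseteq> span ?U"
      by (rule span_mono)
    then show ?thesis
      using that linear_span_image[OF lin, of ?U] by blast
  qed
  then show ?thesis
    by (simp add: lie_ideal_def nilradical_def)
qed

text \<open>Otherwise a basis of \<open>N\<close>, \<open>v\<close> and a vector outside the span
  would be \<open>dim N + 2\<close> independent vectors.\<close>

lemma span_insert_hyperplane:
  fixes N :: "'a::real_vector set"
  assumes "finite B" "span B = (UNIV :: 'a set)"
    and "subspace N" "dim N + 1 = dim (UNIV :: 'a set)" "v \<notin> N"
  shows "span (insert v N) = UNIV"
proof (rule ccontr)
  assume "span (insert v N) \<noteq> UNIV"
  then obtain w where w: "w \<notin> span (insert v N)" by blast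
  obtain C where C: "C \<subseteq> N" "independent C" "N \<subseteq> span C" "card C = dim N"
    using real_vector.basis_exists[of N] by blast
  have spanC: "span C = N"
    using C assms(3) by (simp add: span_minimal subset_antisym)
  have finC: "finite C"
    using real_vector.independent_span_bound[OF assms(1) C(2)] assms(2) by simp
  have vC: "v \<notin> span C" using spanC assms(5) by simp
  then have ind: "independent (insert v C)"
    using C(2) by (simp add: independent_insert)
  have wC: "w \<notin> span (insert v C)"
    using w span_mono[of "insert v C" "insert v N"] C(1) by blast
  then have "independent (insert w (insert v C))"
    using ind by (simp add: independent_insert)
  moreover obtain D where D: "D \<subseteq> UNIV" "independent D" "(UNIV :: 'a set) \<subseteq> span D"
      "card D = dim (UNIV :: 'a set)"
    by (rule real_vector.basis_exists)
  moreover have "finite D"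
    using real_vector.independent_span_bound[OF assms(1) D(2)] assms(2) by simp
  ultimately have "card (insert w (insert v C)) \<le> dim (UNIV :: 'a set)"
    using real_vector.independent_span_bound[of D "insert w (insert v C)"] by auto
  moreover have "card (insert w (insert v C)) = dim N + 2"
    using finC vC wC C(4) by (metis Suc_eq_plus1 add_2_eq_Suc' card_insert_disjoint
        finite_insert span_base)
  ultimately show False using assms(4) by simp
qed

text \<open>Orthogonality to a basis of \<open>N\<close> imposes only \<open>dim N\<close> linear
  conditions on \<open>k\<close>.\<close>

lemma exists_orthogonal_to_proper_subspace:
  fixes N :: "'a::real_vector set" and f :: "'a \<Rightarrow> 'a \<Rightarrow> real"
  assumes "finite B" "span B = (UNIV :: 'a set)"
    and "bilinear f" "dim N < dim (UNIV :: 'a set)"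
  obtains k where "k \<noteq> 0" "\<And>y. y \<in> N \<Longrightarrow> f k y = 0"
proof -
  obtain C where C: "C \<subseteq> N" "independent C" "N \<subseteq> span C" "card C = dim N"
    using real_vector.basis_exists[of N] by blast
  have finC: "finite C"
    using real_vector.independent_span_bound[OF assms(1) C(2)] assms(2) by simp
  obtain D where D: "D \<subseteq> UNIV" "independent D" "(UNIV :: 'a set) \<subseteq> span D"
      "card D = dim (UNIV :: 'a set)"
    by (rule real_vector.basis_exists)
  \<comment> \<open>The values of \<open>f x\<close> on the basis \<open>C\<close> become
    coefficients in \<open>span C\<close>; since \<open>C\<close> is independent, the kernel of
    \<open>T\<close> is exactly what is sought.\<close>
  define T where "T x = (\<Sum>c\<in>C. f x c *\<^sub>R c)" for x
  have linT: "linear T"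
    unfolding T_def
    by (rule linearI)
      (simp_all add: bilinear_ladd[OF assms(3)] bilinear_lmul[OF assms(3)] scaleR_add_left
        sum.distrib scaleR_sum_right)
  have "\<not> inj T"
  proof
    assume inj: "inj T"
    have "independent (T ` D)"
      by (rule linear_independent_injective_image[OF linT D(2)])
        (rule inj_on_subset[OF inj subset_UNIV])
    moreover have "T ` D \<subseteq> span C"
      unfolding T_def by (auto intro: span_sum span_scale span_base)
    ultimately have "card (T ` D) \<le> card C"
      by (rule real_vector.independent_span_bound[OF finC, THEN conjunct2])
    moreover have "card (T ` D) = card D"
      by (rule card_image[OF inj_on_subset[OF inj subset_UNIV]])
    ultimately show False using C(4) D(4) assms(4) by simp
  qed
  then obtain k where k: "k \<noteq> 0" "T k = 0"
    using linear_injective_0[OF linT] by blast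
  have fk: "linear (f k)"
    using assms(3) by (simp add: bilinear_def)
  have "f k c = 0" if "c \<in> C" for c
    using C(2) finC k(2) that unfolding T_def by (metis independentD order_refl)
  then have "f k y = 0" if "y \<in> N" for y
    using linear_eq_0_on_span[OF fk, of C y] C(3) that by blast
  with k show ?thesis using that by blast
qed

section \<open>Construction of the Kaehler metric\<close>

lemma kaehler_metric_of_tamed:
  fixes br :: "'a::real_vector \<Rightarrow> 'a \<Rightarrow> 'a"
  assumes fin: "finite B" "span B = (UNIV :: 'a set)"
    and lie: "lie_bracket br"
    and ideal: "lie_ideal br N" and ab: "abelian br N"
    and codim: "dim N + 1 = dim (UNIV :: 'a set)"
    and J: "complex_structure br J"
    and closed: "closed_two_form br \<Omega>" and tame: "tames \<Omega> J"
  shows "\<exists>g. kaehler_metric br J g"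
proof -
  have sub: "subspace N" and idl: "\<And>x y. y \<in> N \<Longrightarrow> br x y \<in> N"
    using ideal by (auto simp: lie_ideal_def)
  have bil: "bilinear br" and br_self: "\<And>x. br x x = 0"
    using lie by (auto simp: lie_bracket_def)
  note brs = bilinear_ladd[OF bil] bilinear_radd[OF bil] bilinear_lmul[OF bil]
    bilinear_rmul[OF bil] bilinear_lsub[OF bil] bilinear_rsub[OF bil]
  have br_skew: "br x y = - br y x" for x y
    using br_self[of "x + y"] unfolding brs by (simp add: br_self eq_neg_iff_add_eq_0 add.commute)
  have bilO: "bilinear \<Omega>" and O_self: "\<And>x. \<Omega> x x = 0"
    and dO: "\<And>x y z. - \<Omega> (br x y) z + \<Omega> (br x z) y - \<Omega> (br y z) x = 0"
    using closed by (auto simp: closed_two_form_def two_form_def ce_differential_def)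
  note Os = bilinear_ladd[OF bilO] bilinear_radd[OF bilO] bilinear_lmul[OF bilO]
    bilinear_rmul[OF bilO] bilinear_lsub[OF bilO] bilinear_rsub[OF bilO]
    bilinear_lneg[OF bilO] bilinear_rneg[OF bilO] bilinear_lzero[OF bilO] bilinear_rzero[OF bilO]
  have O_skew: "\<Omega> x y = - \<Omega> y x" for x y
    using O_self[of "x + y"] unfolding Os by (simp add: O_self)
  have linJ: "linear J" and JJ: "\<And>x. J (J x) = - x"
    and nij: "\<And>x y. br x y + J (br (J x) y) + J (br x (J y)) - br (J x) (J y) = 0"
    using J by (auto simp: complex_structure_def)
  note Js = linear_add[OF linJ] linear_diff[OF linJ] linear_scale[OF linJ] linear_neg[OF linJ]
    linear_0[OF linJ] JJ
  have pos: "\<Omega> x (J x) > 0" if "x \<noteq> 0" for x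
    using tame that by (simp add: tames_def)
  obtain k where k0: "k \<noteq> 0" and kN: "\<And>y. y \<in> N \<Longrightarrow> \<Omega> k y = 0"
    using exists_orthogonal_to_proper_subspace[OF fin bilO] codim by (metis less_add_one)
  define c where "c = \<Omega> k (J k)"
  have c: "c > 0" using pos[OF k0] by (simp add: c_def)
  \<comment> \<open>The functional with kernel \<open>N\<close>, normalised to 1 at
    \<open>J k\<close>.\<close>
  define \<phi> where "\<phi> x = \<Omega> k x / c" for x
  have \<phi>s: "\<phi> (x + y) = \<phi> x + \<phi> y" "\<phi> (x - y) = \<phi> x - \<phi> y" "\<phi> (- x) = - \<phi> x"
    "\<phi> (r *\<^sub>R x) = r * \<phi> x" for x y r
    by (simp_all add: \<phi>_def Os add_divide_distrib diff_divide_distrib)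
  have \<phi>k: "\<phi> k = 0" and \<phi>Jk: "\<phi> (J k) = 1"
    using c by (simp_all add: \<phi>_def O_self c_def)
  have JkN: "J k \<notin> N"
    using kN c c_def by force
  have decomp: "x - \<phi> x *\<^sub>R J k \<in> N" for x
  proof -
    have "x \<in> span (insert (J k) N)"
      using span_insert_hyperplane[OF fin sub codim JkN] by simp
    then obtain r where r: "x - r *\<^sub>R J k \<in> N"
      using sub by (auto simp: span_breakdown_eq span_eq_iff[THEN iffD2])
    have "\<phi> (x - r *\<^sub>R J k) = 0"
      using kN[OF r] by (simp add: \<phi>_def)
    then have "\<phi> x = r" by (simp add: \<phi>s \<phi>Jk)
    with r show ?thesis by simp
  qed
  have memN: "x \<in> N \<longleftrightarrow> \<phi> x = 0" for x
    using decomp[of x] kN[of x] by (auto simp: \<phi>_def)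
  define b where "b = br (J k)"
  have bs: "b (x + y) = b x + b y" "b (x - y) = b x - b y" "b (r *\<^sub>R x) = r *\<^sub>R b x"
    and bJk: "b (J k) = 0" for x y r
    by (simp_all add: b_def brs br_self)
  \<comment> \<open>As \<open>N\<close> is abelian, the components of \<open>x\<close> and
    \<open>y\<close> in \<open>N\<close> commute; expanding this shows that \<open>b\<close>
    determines the whole bracket.\<close>
  have br_eq: "br x y = \<phi> x *\<^sub>R b y - \<phi> y *\<^sub>R b x" for x y
  proof -
    have "br (x - \<phi> x *\<^sub>R J k) (y - \<phi> y *\<^sub>R J k) = 0"
      using ab decomp by (auto simp: abelian_def)
    then show ?thesis
      using br_skew[of x "J k"] by (simp add: brs br_self b_def algebra_simps)
  qed
  have \<phi>b: "\<phi> (b x) = 0" for x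
  proof -
    have "b x = b (x - \<phi> x *\<^sub>R J k)" by (simp add: bs bJk)
    then show ?thesis
      using idl[OF decomp, of "J k" x] memN by (simp add: b_def)
  qed
  have b_skew: "\<Omega> (b x) y + \<Omega> x (b y) = 0" if "x \<in> N" "y \<in> N" for x y
  proof -
    have "br x y = 0" using that ab by (simp add: abelian_def)
    then show ?thesis
      using dO[of "J k" x y] O_skew[of x "b y"] by (simp add: b_def Os)
  qed
  obtain a where bk: "b k = a *\<^sub>R k"
  proof -
    \<comment> \<open>The multiple of \<open>k\<close> is chosen to make
      \<open>\<Omega> z (J k)\<close> vanish. On \<open>N\<close>, skewness moves \<open>b\<close>
      to the other argument, which stays in \<open>N\<close> and so is orthogonal to
      \<open>k\<close>.\<close>
    define z where "z = b k - (\<Omega> (b k) (J k) / c) *\<^sub>R k"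
    have zN: "\<Omega> z y = 0" if "y \<in> N" for y
      using b_skew[of k y] that kN[of y] kN[of "b y"] memN \<phi>k \<phi>b
      by (simp add: z_def Os)
    have "\<Omega> z (J k) = 0"
      using c by (simp add: z_def Os flip: c_def)
    then have "\<Omega> z y = 0" for y
      using zN[OF decomp[of y]] by (simp add: Os)
    then have "z = 0" using pos[of z] by fastforce
    then show ?thesis using that by (simp add: z_def)
  qed
  \<comment> \<open>Since \<open>x\<close>, \<open>J x\<close> and \<open>k\<close> lie in
    \<open>N\<close>, only the two brackets with \<open>J k\<close> survive in the Nijenhuis
    identity at \<open>x\<close>, \<open>k\<close>.\<close>
  have b_J: "b (J x) = J (b x)" if "\<phi> x = 0" "\<phi> (J x) = 0" for x
    using nij[of x k] that \<phi>k \<phi>Jk by (simp add: br_eq Js)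
  define \<psi> where "\<psi> x = \<phi> (J x)" for x
  have \<psi>s: "\<psi> (x + y) = \<psi> x + \<psi> y" "\<psi> (x - y) = \<psi> x - \<psi> y" "\<psi> (r *\<^sub>R x) = r * \<psi> x"
    "\<psi> (J x) = - \<phi> x" "\<phi> (J x) = \<psi> x" for x y r
    by (simp_all add: \<psi>_def Js \<phi>s)
  \<comment> \<open>The projection onto the common kernel of \<open>\<phi>\<close> and
    \<open>\<psi>\<close>, which is the intersection of \<open>N\<close> and \<open>J N\<close>,
    along the plane of \<open>k\<close> and \<open>J k\<close>.\<close>
  define P where "P x = x - \<psi> x *\<^sub>R k - \<phi> x *\<^sub>R J k" for x
  have Ps: "P (x + y) = P x + P y" "P (x - y) = P x - P y" "P (r *\<^sub>R x) = r *\<^sub>R P x"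
    "P (J x) = J (P x)" for x y r
    by (simp_all add: P_def \<psi>s \<phi>s Js algebra_simps)
  have \<psi>k: "\<psi> k = 1" using \<phi>Jk by (simp add: \<psi>_def)
  have \<phi>P: "\<phi> (P x) = 0" and \<psi>P: "\<psi> (P x) = 0" for x
    using \<phi>Jk by (simp_all add: P_def \<phi>s \<psi>s \<phi>k \<psi>k)
  have bP: "b x = b (P x) + (a * \<psi> x) *\<^sub>R k" for x
    by (simp add: P_def bs bJk bk)
  have \<psi>bP: "\<psi> (b (P x)) = 0" for x
    using b_J[of "P x"] \<phi>P \<psi>P \<phi>b by (metis \<psi>_def)
  have \<psi>b: "\<psi> (b x) = a * \<psi> x" for x
    using bP[of x] by (simp add: \<psi>s \<psi>bP \<psi>k)
  have Pb: "P (b x) = b (P x)" for x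
    using bP[of x] unfolding P_def[of "b x"] \<psi>b \<phi>b by simp
  have bJP: "b (J (P x)) = J (b (P x))" for x
    using b_J[of "P x"] \<phi>P \<psi>P by (simp add: \<psi>_def)
  \<comment> \<open>Taming alone does not make \<open>\<Omega> x (J y)\<close> symmetric;
    symmetrising it amounts to passing to the (1,1)-part.\<close>
  define g where "g x y = (\<Omega> (P x) (J (P y)) + \<Omega> (P y) (J (P x))) / 2 + \<psi> x * \<psi> y + \<phi> x * \<phi> y"
    for x y
  have g_bil: "bilinear g"
    unfolding bilinear_def g_def
    by (auto intro!: linearI simp: Ps Os \<phi>s \<psi>s Js field_simps)
  have g_sym: "g x y = g y x" for x y
    by (simp add: g_def)
  have g_pos: "g x x > 0" if "x \<noteq> 0" for x
  proof (cases "P x = 0")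
    case True
    then have "\<psi> x \<noteq> 0 \<or> \<phi> x \<noteq> 0"
      using that by (auto simp: P_def)
    then show ?thesis
      using True by (simp add: g_def Os sum_squares_gt_zero_iff)
  next
    case False
    then show ?thesis
      using pos[OF False] by (simp add: g_def add_pos_nonneg)
  qed
  have g_J: "g (J x) (J y) = g x y" for x y
    using O_skew[of "J (P x)" "P y"] O_skew[of "J (P y)" "P x"]
    by (simp add: g_def Ps \<psi>s Js Os)
  define \<omega> where "\<omega> x y = g (J x) y" for x y
  have \<omega>_eq: "\<omega> x y = (\<Omega> (P x) (P y) + \<Omega> (J (P x)) (J (P y))) / 2 + \<psi> x * \<phi> y - \<phi> x * \<psi> y"
    for x y
    using O_skew[of "P x" "P y"] by (simp add: \<omega>_def g_def Ps \<psi>s Js Os)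
  have \<omega>_bil: "bilinear \<omega>"
    unfolding bilinear_def \<omega>_eq
    by (auto intro!: linearI simp: Ps Os \<phi>s \<psi>s Js field_simps)
  have \<omega>_self: "\<omega> x x = 0" for x
    by (simp add: \<omega>_eq O_self)
  have \<omega>_skew: "\<omega> x y = - \<omega> y x" for x y
    using O_skew[of "P x" "P y"] O_skew[of "J (P x)" "J (P y)"]
    by (simp add: \<omega>_eq field_simps)
  \<comment> \<open>Skewness of \<open>b\<close>, used on the image of \<open>P\<close> both before
    and after applying \<open>J\<close>, cancels the first part of \<open>\<omega>\<close>. What
    remains comes from \<open>b k = a *\<^sub>R k\<close>.\<close>
  have \<omega>_b: "\<omega> (b x) y + \<omega> x (b y) = a * (\<psi> x * \<phi> y - \<phi> x * \<psi> y)" for x y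
  proof -
    have "\<Omega> (b (P x)) (P y) + \<Omega> (P x) (b (P y)) = 0"
      by (rule b_skew) (simp_all add: memN \<phi>P)
    moreover have "\<Omega> (b (J (P x))) (J (P y)) + \<Omega> (J (P x)) (b (J (P y))) = 0"
      by (rule b_skew) (simp_all add: memN \<psi>P \<psi>s)
    ultimately show ?thesis
      by (simp add: \<omega>_eq Pb bJP \<phi>b \<psi>b field_simps)
  qed
  note \<omega>s = bilinear_lsub[OF \<omega>_bil] bilinear_lmul[OF \<omega>_bil]
  have "ce_differential br \<omega> x y z = 0" for x y z
  proof -
    have "ce_differential br \<omega> x y z =
      - \<phi> x * (\<omega> (b y) z + \<omega> y (b z)) + \<phi> y * (\<omega> (b x) z + \<omega> x (b z))
      - \<phi> z * (\<omega> (b x) y + \<omega> x (b y))"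
      using \<omega>_skew[of y "b z"] \<omega>_skew[of x "b z"] \<omega>_skew[of x "b y"]
      by (simp add: ce_differential_def br_eq \<omega>s algebra_simps)
    \<comment> \<open>Up to sign this is \<open>a\<close> times the wedge of \<open>\<phi>\<close>
      with that of \<open>\<psi>\<close> and \<open>\<phi>\<close>; it vanishes for every
      \<open>a\<close> because \<open>\<phi>\<close> occurs twice.\<close>
    also have "\<dots> = 0"
      unfolding \<omega>_b by (simp add: algebra_simps)
    finally show ?thesis .
  qed
  then have "closed_two_form br \<omega>"
    using \<omega>_bil \<omega>_self by (simp add: closed_two_form_def two_form_def)
  then have "closed_two_form br (\<lambda>x y. g (J x) y)"
    by (simp add: \<omega>_def[abs_def])
  then have "kaehler_metric br J g"
    using g_bil g_sym g_pos g_J by (simp add: kaehler_metric_def inner_product_form_def)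
  then show ?thesis by blast
qed

theorem theorem6p1:
  fixes br :: "'a::real_vector \<Rightarrow> 'a \<Rightarrow> 'a"
    and J :: "'a \<Rightarrow> 'a"
    and n :: nat
  assumes "\<exists>B :: 'a set. finite B \<and> span B = UNIV"
    and "dim (UNIV :: 'a set) = 2 * n"
    and "lie_bracket br"
    and "almost_abelian br"
    and "complex_structure br J"
    and "\<not> (\<exists>g. kaehler_metric br J g)"
  shows "\<not> (\<exists>\<Omega>. symplectic_structure br \<Omega> \<and> tames \<Omega> J)"
proof
  assume "\<exists>\<Omega>. symplectic_structure br \<Omega> \<and> tames \<Omega> J"
  then obtain \<Omega> where "closed_two_form br \<Omega>" "tames \<Omega> J"
    by (auto simp: symplectic_structure_def)
  moreover obtain B :: "'a set" where "finite B" "span B = UNIV"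
    using assms(1) by blast
  ultimately show False
    using kaehler_metric_of_tamed[of B br "nilradical br" J \<Omega>] lie_ideal_nilradical assms(3-6)
    by (auto simp: almost_abelian_def)
qed

end
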